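(* Let $n\ge 1$, let $N$ be an $n$-dimensional $C^\infty$ manifold without boundary, let $(\widetilde f,\widetilde\nu): N\to\mathbb{R}^{n+1}\times S^n$ be a frontal, and let $P\in\mathbb{R}^{n+1}$ be a point such that $(\widetilde f(x)-P)\cdot\widetilde\nu(x)\neq 0$ for every $x\in N$. Then the pedal of $\widetilde f$ relative to $P$, defined by $$g(x)=\left((\widetilde f(x)-P)\cdot\widetilde\nu(x)\right)\widetilde\nu(x)+P,$$ is a frontal with Gauss mapping $\nu(x)=\frac{2g(x)-P-\widetilde f(x)}{\|2g(x)-P-\widetilde f(x)\|}$. Moreover, $(g(x)-P)\cdot\nu(x)\neq 0$ holds for every $x\in N$.
   Context: All mappings are of class $C^\infty$. $S^n\subset\mathbb{R}^{n+1}$ is the unit sphere, $\cdot$ is the Euclidean scalar product, and $T_{y}\mathbb{R}^{n+1}$ is identified with $\mathbb{R}^{n+1}$. A mapping $f:N\to\mathbb{R}^{n+1}$ is a frontal if there is a mapping $\nu:N\to S^n$ (called its Gauss mapping) with $df_x(\mathbf v)\cdot\nu(x)=0$ for all $x\in N$, $\mathbf v\in T_xN$; the pair $(f,\nu)$ is also called a frontal. *)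

theory Defs
  imports "HOL-Analysis.Analysis"
begin

text \<open>
  Iterated continuous differentiability on an open set \<open>S\<close>: a map is \<open>C\<^sup>k\<^sup>+\<^sup>1\<close> if it is
  differentiable and each of its directional derivatives is \<open>C\<^sup>k\<close>.
  The definition is intended for open \<open>S\<close> only, as it uses derivatives at \<open>x\<close>, not
  derivatives within \<open>S\<close>.
\<close>

primrec Ck_on :: "nat \<Rightarrow> 'a::euclidean_space set \<Rightarrow> ('a \<Rightarrow> 'b::real_normed_vector) \<Rightarrow> bool" where
  "Ck_on 0 S f \<longleftrightarrow> continuous_on S f"
| "Ck_on (Suc k) S f \<longleftrightarrow>
     (\<forall>x\<in>S. f differentiable (at x)) \<and>
     (\<forall>v. Ck_on k S (\<lambda>x. frechet_derivative f (at x) v))"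

definition smooth_on :: "'a::euclidean_space set \<Rightarrow> ('a \<Rightarrow> 'b::real_normed_vector) \<Rightarrow> bool" where
  "smooth_on S f \<longleftrightarrow> (\<forall>k. Ck_on k S f)"

text \<open>
  A manifold without boundary of dimension \<open>CARD('n)\<close>, with point set \<open>topspace N\<close>.
  A chart is a pair of its domain and a coordinate map; the coordinate map is
  meaningful on the domain only. The atlas \<open>A\<close> need not be maximal.
\<close>

locale smooth_manifold =
  fixes N :: "'a topology"
    and A :: "('a set \<times> ('a \<Rightarrow> real ^ 'n)) set"
  assumes Hausdorff: "Hausdorff_space N"
    and second_countable: "second_countable N"
    and covers: "(\<Union>(U, \<phi>)\<in>A. U) = topspace N"
    and open_domain: "(U, \<phi>) \<in> A \<Longrightarrow> openin N U"
    and open_codomain: "(U, \<phi>) \<in> A \<Longrightarrow> open (\<phi> ` U)"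
    and chart_homeomorphic:
      "(U, \<phi>) \<in> A \<Longrightarrow> homeomorphic_map (subtopology N U) (top_of_set (\<phi> ` U)) \<phi>"
    and transition_smooth:
      "(U, \<phi>) \<in> A \<Longrightarrow> (V, \<psi>) \<in> A \<Longrightarrow> smooth_on (\<phi> ` (U \<inter> V)) (\<psi> \<circ> inv_into U \<phi>)"

definition smooth_map ::
    "('a set \<times> ('a \<Rightarrow> real ^ 'n)) set \<Rightarrow> ('a \<Rightarrow> 'b::real_normed_vector) \<Rightarrow> bool" where
  "smooth_map A f \<longleftrightarrow> (\<forall>(U, \<phi>)\<in>A. smooth_on (\<phi> ` U) (f \<circ> inv_into U \<phi>))"

text \<open>
  Tangent vectors at \<open>x\<close> are the derivations at \<open>x\<close> of the algebra of smooth real functions.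
  Functions on the manifold are represented by total functions on \<open>'a\<close>, but
  the Leibniz rule forces a derivation to depend only on the values on the manifold:
  if \<open>h\<close> vanishes there, then \<open>h = h * e\<close> with \<open>e\<close> the indicator function of the
  complement, so \<open>D h = h x * D e + e x * D h = 0\<close>.
\<close>

definition tangent_space ::
    "('a set \<times> ('a \<Rightarrow> real ^ 'n)) set \<Rightarrow> 'a \<Rightarrow> (('a \<Rightarrow> real) \<Rightarrow> real) set" where
  "tangent_space A x = {D \<in> extensional {h. smooth_map A h}.
     (\<forall>h k a b. smooth_map A h \<longrightarrow> smooth_map A k \<longrightarrow>
        D (\<lambda>y. a * h y + b * k y) = a * D h + b * D k) \<and>
     (\<forall>h k. smooth_map A h \<longrightarrow> smooth_map A k \<longrightarrow>
        D (\<lambda>y. h y * k y) = h x * D k + k x * D h)}"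

text \<open>
  The differential \<open>df\<^sub>x(v)\<close> is the derivation \<open>h \<mapsto> v (h \<circ> f)\<close> at \<open>f x\<close>. The identification of the
  tangent spaces of \<open>real ^ 'm\<close> with \<open>real ^ 'm\<close> sends a derivation to the vector of its values
  on the coordinate functions, which gives the formula below; it does not depend on \<open>x\<close>
  except through \<open>v\<close>.
\<close>

definition differential :: "('a \<Rightarrow> real ^ 'm) \<Rightarrow> (('a \<Rightarrow> real) \<Rightarrow> real) \<Rightarrow> real ^ 'm" where
  "differential f v = (\<chi> i. v (\<lambda>y. f y $ i))"

text \<open>
  A smooth map into the unit sphere is a smooth map into the ambient space with values
  in the sphere.
\<close>

definition frontal ::
    "'a topology \<Rightarrow> ('a set \<times> ('a \<Rightarrow> real ^ 'n)) set \<Rightarrow>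
     ('a \<Rightarrow> real ^ 'm) \<Rightarrow> ('a \<Rightarrow> real ^ 'm) \<Rightarrow> bool" where
  "frontal N A f \<nu> \<longleftrightarrow>
     smooth_map A f \<and> smooth_map A \<nu> \<and> \<nu> ` topspace N \<subseteq> sphere 0 1 \<and>
     (\<forall>x\<in>topspace N. \<forall>v\<in>tangent_space A x. differential f v \<bullet> \<nu> x = 0)"

definition pedal ::
    "('a \<Rightarrow> real ^ 'm) \<Rightarrow> ('a \<Rightarrow> real ^ 'm) \<Rightarrow> real ^ 'm \<Rightarrow> 'a \<Rightarrow> real ^ 'm" where
  "pedal f \<nu> P x = ((f x - P) \<bullet> \<nu> x) *\<^sub>R \<nu> x + P"

end

theory Submission
  imports Defs
begin

text \<open>
  Put \<open>F = f - P\<close>, \<open>a = F \<bullet> \<nu>\<close> and \<open>w = 2 g - P - f = 2 a \<nu> - F\<close>, so that \<open>\<nu> \<bullet> w = a \<noteq> 0\<close>.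
  Since \<open>df \<bullet> \<nu> = 0\<close> we have \<open>da = F \<bullet> d\<nu>\<close>, hence \<open>dg = (F \<bullet> d\<nu>) \<nu> + a d\<nu>\<close>. As \<open>\<nu> \<bullet> d\<nu> = 0\<close>,
  \<open>d\<nu> \<bullet> w = - (F \<bullet> d\<nu>)\<close>, and the two terms of \<open>dg \<bullet> w\<close> cancel.
  The map \<open>r = 1 / norm w\<close> is smooth by induction on the order of differentiability, because
  its derivative \<open>- r^3 (w \<bullet> dw)\<close> is a polynomial in \<open>r\<close>, \<open>w\<close> and \<open>dw\<close>.
\<close>

section \<open>Calculus of \<open>Ck_on\<close> maps on open sets\<close>

lemma Ck_on_cong:
  assumes "open S" "\<And>x. x \<in> S \<Longrightarrow> f x = g x"
  shows "Ck_on k S f \<longleftrightarrow> Ck_on k S g"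
  using assms(2)
proof (induction k arbitrary: f g)
  case 0
  then show ?case by (simp cong: continuous_on_cong)
next
  case (Suc k)
  \<comment> \<open>As \<open>S\<close> is open, \<open>f\<close> and \<open>g\<close> agree near
    each point of \<open>S\<close>, so they have the same derivatives there, whatever their values
    outside \<open>S\<close>.\<close>
  have iff: "(f has_derivative D) (at x) \<longleftrightarrow> (g has_derivative D) (at x)" if "x \<in> S" for x D
    using has_derivative_transform_within_open[OF _ \<open>open S\<close> that] Suc.prems by metis
  then have "frechet_derivative f (at x) = frechet_derivative g (at x)" if "x \<in> S" for x
    using that by (simp add: frechet_derivative_def)
  then have "Ck_on k S (\<lambda>x. frechet_derivative f (at x) v) \<longleftrightarrow>
      Ck_on k S (\<lambda>x. frechet_derivative g (at x) v)" for v
    by (intro Suc.IH) simp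
  then show ?case
    using iff by (simp add: differentiable_def)
qed

text \<open>Allows an explicit formula for the derivative in place of
  \<open>frechet_derivative\<close>; the two agree by uniqueness of the derivative, and agreement on
  \<open>S\<close> is enough.\<close>

lemma Ck_on_SucI:
  assumes "open S" "\<And>x. x \<in> S \<Longrightarrow> (f has_derivative f' x) (at x)"
    and "\<And>v. Ck_on k S (\<lambda>x. f' x v)"
  shows "Ck_on (Suc k) S f"
proof -
  have "frechet_derivative f (at x) = f' x" if "x \<in> S" for x
    using frechet_derivative_at[OF assms(2)[OF that]] by simp
  then have "Ck_on k S (\<lambda>x. frechet_derivative f (at x) v) \<longleftrightarrow> Ck_on k S (\<lambda>x. f' x v)" for v
    by (intro Ck_on_cong[OF \<open>open S\<close>]) simp
  then show ?thesis
    using assms(2,3) by (auto simp: differentiable_def)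
qed

lemma Ck_on_has_derivative:
  assumes "Ck_on (Suc k) S f" "x \<in> S"
  shows "(f has_derivative frechet_derivative f (at x)) (at x)"
  using assms by (auto simp: frechet_derivative_works)

lemma Ck_on_Suc_imp: "Ck_on (Suc k) S f \<Longrightarrow> Ck_on k S f"
proof (induction k arbitrary: f)
  case 0
  then show ?case
    by (simp add: continuous_at_imp_continuous_on differentiable_imp_continuous_within)
next
  case (Suc k)
  then have "Ck_on k S (\<lambda>x. frechet_derivative f (at x) v)" for v
    using Ck_on.simps(2)[of "Suc k" S f] by blast
  then show ?case
    using Suc.prems by simp
qed

lemma Ck_on_const: "open S \<Longrightarrow> Ck_on k S (\<lambda>_. c)"
proof (induction k arbitrary: c)
  case (Suc k)
  then show ?case
    by (auto intro: Ck_on_SucI[where f' = "\<lambda>_ _. 0"])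
qed simp

lemma Ck_on_add:
  assumes "open S" "Ck_on k S f" "Ck_on k S g"
  shows "Ck_on k S (\<lambda>x. f x + g x)"
  using assms(2,3)
proof (induction k arbitrary: f g)
  case (Suc k)
  show ?case
    by (rule Ck_on_SucI[OF \<open>open S\<close>
          has_derivative_add[OF Ck_on_has_derivative[OF Suc.prems(1)]
            Ck_on_has_derivative[OF Suc.prems(2)]]])
      (use Suc in auto)
qed (simp add: continuous_on_add)

text \<open>Treats multiplication, scaling and the inner product at once.\<close>

lemma (in bounded_bilinear) Ck_on:
  assumes "open S" "Ck_on k S f" "Ck_on k S g"
  shows "Ck_on k S (\<lambda>x. prod (f x) (g x))"
  using assms(2,3)
proof (induction k arbitrary: f g)
  case (Suc k)
  show ?case
  proof (rule Ck_on_SucI[OF \<open>open S\<close>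
        FDERIV[OF Ck_on_has_derivative[OF Suc.prems(1)] Ck_on_has_derivative[OF Suc.prems(2)]]])
    show "Ck_on k S (\<lambda>x. prod (f x) (frechet_derivative g (at x) v) +
        prod (frechet_derivative f (at x) v) (g x))" for v
      \<comment> \<open>The Leibniz rule also contains the undifferentiated factors, so these have
        to be lowered from order \<open>Suc k\<close> to order \<open>k\<close>.\<close>
      using Suc.prems Suc.prems[THEN Ck_on_Suc_imp]
      by (intro Ck_on_add[OF \<open>open S\<close>] Suc.IH) auto
  qed
qed (simp add: continuous_on)

lemma Ck_on_inverse_norm:
  fixes f :: "'a::euclidean_space \<Rightarrow> 'b::real_inner"
  assumes "open S" "Ck_on k S f" "\<And>x. x \<in> S \<Longrightarrow> f x \<noteq> 0"
  shows "Ck_on k S (\<lambda>x. inverse (norm (f x)))"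
  using assms(2)
proof (induction k)
  case 0
  then show ?case
    using assms(3) by (simp add: continuous_on_inverse continuous_on_norm)
next
  case (Suc k)
  define r where "r = (\<lambda>x. inverse (norm (f x)))"
  define f' where "f' = (\<lambda>x. frechet_derivative f (at x))"
  note mult = bounded_bilinear.Ck_on[OF bounded_bilinear_mult \<open>open S\<close>]
  have f: "Ck_on k S f"
    using Suc.prems by (rule Ck_on_Suc_imp)
  then have r: "Ck_on k S r"
    unfolding r_def by (rule Suc.IH)
  have "Ck_on (Suc k) S r"
  proof (rule Ck_on_SucI[OF \<open>open S\<close>])
    fix x assume "x \<in> S"
    have "((\<lambda>x. norm (f x)) has_derivative (\<lambda>v. f' x v \<bullet> sgn (f x))) (at x)"
      using has_derivative_compose[OF Ck_on_has_derivative[OF Suc.prems \<open>x \<in> S\<close>]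
          has_derivative_norm[OF assms(3)[OF \<open>x \<in> S\<close>]]]
      by (simp add: f'_def)
    from Deriv.has_derivative_inverse[OF _ this]
    \<comment> \<open>Chain rule with \<open>sgn (f x) = r x *\<^sub>R f x\<close>. The sign is kept
      as a constant factor, so that the rules for products and constants cover the whole
      expression.\<close>
    show "(r has_derivative (\<lambda>v. (- 1) * (r x * (r x * r x) * (f x \<bullet> f' x v)))) (at x)"
      using assms(3)[OF \<open>x \<in> S\<close>]
      by (simp add: r_def sgn_div_norm inner_commute mult_ac)
  next
    fix v
    have "Ck_on k S (\<lambda>x. f' x v)"
      using Suc.prems by (simp add: f'_def)
    then show "Ck_on k S (\<lambda>x. (- 1) * (r x * (r x * r x) * (f x \<bullet> f' x v)))"
      by (intro mult bounded_bilinear.Ck_on[OF bounded_bilinear_inner] Ck_on_const f r \<open>open S\<close>)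
  qed
  then show ?case by (simp add: r_def)
qed

section \<open>Smooth maps on a manifold\<close>

context smooth_manifold
begin

lemma inv_into_chart_in_topspace:
  assumes "(U, \<phi>) \<in> A" "y \<in> \<phi> ` U"
  shows "inv_into U \<phi> y \<in> topspace N"
  using openin_subset[OF open_domain[OF assms(1)]] inv_into_into[OF assms(2)] by (rule subsetD)

lemma smooth_map_iff:
  "smooth_map A f \<longleftrightarrow> (\<forall>U \<phi> k. (U, \<phi>) \<in> A \<longrightarrow> Ck_on k (\<phi> ` U) (\<lambda>y. f (inv_into U \<phi> y)))"
  by (auto simp: smooth_map_def smooth_on_def o_def)

text \<open>Smoothness is tested through inverse charts only, and their values lie in
  \<open>topspace N\<close>.\<close>

lemma smooth_map_cong:
  assumes "\<And>x. x \<in> topspace N \<Longrightarrow> f x = g x"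
  shows "smooth_map A f \<longleftrightarrow> smooth_map A g"
proof -
  have "Ck_on k (\<phi> ` U) (\<lambda>y. f (inv_into U \<phi> y)) \<longleftrightarrow> Ck_on k (\<phi> ` U) (\<lambda>y. g (inv_into U \<phi> y))"
    if "(U, \<phi>) \<in> A" for U \<phi> k
    by (rule Ck_on_cong[OF open_codomain[OF that]])
      (rule assms, rule inv_into_chart_in_topspace[OF that])
  then show ?thesis
    by (simp add: smooth_map_iff cong: imp_cong)
qed

lemma smooth_map_const [simp]: "smooth_map A (\<lambda>_. c)"
  unfolding smooth_map_iff by (simp add: Ck_on_const open_codomain)

lemma smooth_map_add [simp]:
  "smooth_map A f \<Longrightarrow> smooth_map A g \<Longrightarrow> smooth_map A (\<lambda>x. f x + g x)"
  unfolding smooth_map_iff by (simp add: Ck_on_add open_codomain)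

lemma smooth_map_bilinear:
  "bounded_bilinear p \<Longrightarrow> smooth_map A f \<Longrightarrow> smooth_map A g \<Longrightarrow> smooth_map A (\<lambda>x. p (f x) (g x))"
  unfolding smooth_map_iff
  by (intro allI impI, rule bounded_bilinear.Ck_on) (simp_all add: open_codomain)

lemmas smooth_map_mult [simp] = smooth_map_bilinear[OF bounded_bilinear_mult]
  and smooth_map_scaleR [simp] = smooth_map_bilinear[OF bounded_bilinear_scaleR]
  and smooth_map_inner [simp] = smooth_map_bilinear[OF bounded_bilinear_inner]

lemma smooth_map_diff [simp]:
  "smooth_map A f \<Longrightarrow> smooth_map A g \<Longrightarrow> smooth_map A (\<lambda>x. f x - g x)"
  using smooth_map_add[OF _ smooth_map_scaleR[OF smooth_map_const[of "- 1"]], of f g] by simp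

lemma smooth_map_component [simp]:
  assumes "smooth_map A (f :: 'a \<Rightarrow> real ^ 'm)"
  shows "smooth_map A (\<lambda>x. f x $ i)"
  using smooth_map_inner[OF assms smooth_map_const[of "axis i 1"]] by (simp add: inner_axis)

lemma smooth_map_inverse_norm:
  fixes f :: "'a \<Rightarrow> 'b::real_inner"
  assumes "smooth_map A f" "\<And>x. x \<in> topspace N \<Longrightarrow> f x \<noteq> 0"
  shows "smooth_map A (\<lambda>x. inverse (norm (f x)))"
  unfolding smooth_map_iff
proof (intro allI impI)
  fix U \<phi> k assume U: "(U, \<phi>) \<in> A"
  show "Ck_on k (\<phi> ` U) (\<lambda>y. inverse (norm (f (inv_into U \<phi> y))))"
    using assms(1) U
    by (intro Ck_on_inverse_norm open_codomain[OF U] assms(2) inv_into_chart_in_topspace[OF U])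
      (auto simp: smooth_map_iff)
qed

section \<open>Tangent vectors as derivations\<close>

lemma tangent_lincomb:
  assumes "v \<in> tangent_space A x" "smooth_map A h" "smooth_map A k"
  shows "v (\<lambda>y. a * h y + b * k y) = a * v h + b * v k"
  using assms by (simp add: tangent_space_def)

lemma tangent_mult:
  assumes "v \<in> tangent_space A x" "smooth_map A h" "smooth_map A k"
  shows "v (\<lambda>y. h y * k y) = h x * v k + k x * v h"
  using assms by (simp add: tangent_space_def)

lemma tangent_add:
  assumes "v \<in> tangent_space A x" "smooth_map A h" "smooth_map A k"
  shows "v (\<lambda>y. h y + k y) = v h + v k"
  using tangent_lincomb[OF assms, of 1 1] by simp

lemma tangent_diff:
  assumes "v \<in> tangent_space A x" "smooth_map A h" "smooth_map A k"
  shows "v (\<lambda>y. h y - k y) = v h - v k"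
  using tangent_lincomb[OF assms, of 1 "- 1"] by simp

lemma tangent_const:
  assumes "v \<in> tangent_space A x"
  shows "v (\<lambda>_. c) = 0"
proof -
  \<comment> \<open>The Leibniz rule for 1 = 1 * 1 says that this value equals its own
    double.\<close>
  have "v (\<lambda>_. 1) = 0"
    using tangent_mult[OF assms smooth_map_const[of 1] smooth_map_const[of 1]] by simp
  then show ?thesis
    using tangent_lincomb[OF assms smooth_map_const[of 1] smooth_map_const[of 1], of c 0] by simp
qed

lemma smooth_map_sum:
  "(\<And>i. i \<in> I \<Longrightarrow> smooth_map A (h i)) \<Longrightarrow> smooth_map A (\<lambda>y. \<Sum>i\<in>I. h i y)"
  by (induction I rule: infinite_finite_induct) auto

lemma tangent_sum:
  assumes "v \<in> tangent_space A x" "\<And>i. i \<in> I \<Longrightarrow> smooth_map A (h i)"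
  shows "v (\<lambda>y. \<Sum>i\<in>I. h i y) = (\<Sum>i\<in>I. v (h i))"
  using assms(2)
proof (induction I rule: infinite_finite_induct)
  case (insert i I)
  then show ?case
    by (simp add: tangent_add[OF assms(1)] smooth_map_sum)
qed (simp_all add: tangent_const[OF assms(1)])

text \<open>Leibniz rule in each coordinate, summed over the coordinates.\<close>

lemma tangent_inner:
  fixes f g :: "'a \<Rightarrow> real ^ 'm"
  assumes v: "v \<in> tangent_space A x" and "smooth_map A f" "smooth_map A g"
  shows "v (\<lambda>y. f y \<bullet> g y) = f x \<bullet> differential g v + differential f v \<bullet> g x"
  using assms
  by (simp add: inner_vec_def tangent_sum[OF v] tangent_mult[OF v] differential_def
      sum.distrib mult.commute)

text \<open>Needed because \<open>v\<close> acts on total functions, whereas identities such as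
  \<nu> \<bullet> \<nu> = 1 are known on the manifold only.\<close>

lemma tangent_cong:
  assumes v: "v \<in> tangent_space A x" and x: "x \<in> topspace N"
    and "smooth_map A h" "smooth_map A k" and eq: "\<And>y. y \<in> topspace N \<Longrightarrow> h y = k y"
  shows "v h = v k"
proof -
  define e :: "'a \<Rightarrow> real" where "e = indicator (- topspace N)"
  have e: "smooth_map A e"
    using smooth_map_cong[of e "\<lambda>_. 0"] by (simp add: e_def)
  \<comment> \<open>On the manifold both sides vanish; off it \<open>e\<close> is 1. At
    \<open>x\<close> both factors are 0, so the Leibniz rule gives 0.\<close>
  have "(\<lambda>y. h y - k y) = (\<lambda>y. (h y - k y) * e y)"
    using eq by (auto simp: e_def fun_eq_iff indicator_def)
  then have "v (\<lambda>y. h y - k y) = v (\<lambda>y. (h y - k y) * e y)"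
    by (rule arg_cong)
  also have "\<dots> = 0"
    using x eq assms(3,4) e by (simp add: tangent_mult[OF v] e_def)
  finally show ?thesis
    using assms(3,4) by (simp add: tangent_diff[OF v])
qed

text \<open>Differentiate \<nu> \<bullet> \<nu> = 1, which yields twice the inner product in
  question.\<close>

lemma differential_inner_unit_eq_0:
  fixes \<nu> :: "'a \<Rightarrow> real ^ 'm"
  assumes v: "v \<in> tangent_space A x" and x: "x \<in> topspace N"
    and \<nu>: "smooth_map A \<nu>" and unit: "\<nu> ` topspace N \<subseteq> sphere 0 1"
  shows "differential \<nu> v \<bullet> \<nu> x = 0"
proof -
  have "v (\<lambda>y. \<nu> y \<bullet> \<nu> y) = v (\<lambda>_. 1)"
    by (rule tangent_cong[OF v x smooth_map_inner[OF \<nu> \<nu>] smooth_map_const])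
      (use unit in \<open>auto simp: dot_square_norm\<close>)
  then show ?thesis
    unfolding tangent_inner[OF v \<nu> \<nu>] tangent_const[OF v] inner_commute[of "\<nu> x"] by simp
qed

text \<open>Leibniz rule twice: for the coefficient (f - P) \<bullet> \<nu>, then for its product
  with \<nu>. The summand \<open>differential f v \<bullet> \<nu> x\<close> vanishes once the pair
  is a frontal.\<close>

lemma differential_pedal:
  fixes f \<nu> :: "'a \<Rightarrow> real ^ 'm"
  assumes v: "v \<in> tangent_space A x" and f: "smooth_map A f" and \<nu>: "smooth_map A \<nu>"
  shows "differential (pedal f \<nu> P) v =
    ((f x - P) \<bullet> differential \<nu> v + differential f v \<bullet> \<nu> x) *\<^sub>R \<nu> x +
    ((f x - P) \<bullet> \<nu> x) *\<^sub>R differential \<nu> v"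
proof -
  define a where "a = (\<lambda>y. (f y - P) \<bullet> \<nu> y)"
  have a: "smooth_map A a"
    using f \<nu> by (simp add: a_def)
  have "differential (\<lambda>y. f y - P) v = differential f v"
    using f by (simp add: differential_def tangent_diff[OF v] tangent_const[OF v])
  then have "v a = (f x - P) \<bullet> differential \<nu> v + differential f v \<bullet> \<nu> x"
    using tangent_inner[OF v smooth_map_diff[OF f smooth_map_const] \<nu>] by (simp add: a_def)
  moreover have "differential (\<lambda>y. a y *\<^sub>R \<nu> y + P) v = v a *\<^sub>R \<nu> x + a x *\<^sub>R differential \<nu> v"
    using a \<nu>
    by (simp add: vec_eq_iff differential_def tangent_add[OF v] tangent_mult[OF v]
        tangent_const[OF v] mult.commute)
  ultimately show ?thesis
    by (simp add: a_def pedal_def[abs_def])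
qed

end

theorem corollary1:
  fixes N :: "'a topology"
    and A :: "('a set \<times> ('a \<Rightarrow> real ^ 'n)) set"
    and f \<nu> :: "'a \<Rightarrow> real ^ 'm"
    and P :: "real ^ 'm"
  assumes "CARD('m) = CARD('n) + 1"
    and "smooth_manifold N A"
    and "frontal N A f \<nu>"
    and "\<forall>x\<in>topspace N. (f x - P) \<bullet> \<nu> x \<noteq> 0"
  shows "let g = pedal f \<nu> P;
             \<nu>\<^sub>g = (\<lambda>x. (2 *\<^sub>R g x - P - f x) /\<^sub>R norm (2 *\<^sub>R g x - P - f x))
         in frontal N A g \<nu>\<^sub>g \<and> (\<forall>x\<in>topspace N. (g x - P) \<bullet> \<nu>\<^sub>g x \<noteq> 0)"
proof -
  interpret smooth_manifold N A by fact
  have f: "smooth_map A f" and \<nu>: "smooth_map A \<nu>" and unit: "\<nu> ` topspace N \<subseteq> sphere 0 1"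
    and normal: "\<And>x v. x \<in> topspace N \<Longrightarrow> v \<in> tangent_space A x \<Longrightarrow> differential f v \<bullet> \<nu> x = 0"
    using assms(3) by (auto simp: frontal_def)
  define g where "g = pedal f \<nu> P"
  define w where "w = (\<lambda>x. 2 *\<^sub>R g x - P - f x)"
  define a where "a = (\<lambda>x. (f x - P) \<bullet> \<nu> x)"
  have g: "g x = a x *\<^sub>R \<nu> x + P" for x
    by (simp add: g_def pedal_def a_def)
  have w: "w x = (2 * a x) *\<^sub>R \<nu> x - (f x - P)" for x
    by (simp add: w_def g algebra_simps scaleR_2)
  have a_nz: "a x \<noteq> 0" and \<nu>_\<nu>: "\<nu> x \<bullet> \<nu> x = 1" if "x \<in> topspace N" for x
    using assms(4) unit that by (auto simp: a_def dot_square_norm)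
  have \<nu>_w: "\<nu> x \<bullet> w x = a x" if "x \<in> topspace N" for x
    using \<nu>_\<nu>[OF that] by (simp add: w a_def inner_diff_right inner_commute)
  \<comment> \<open>If \<open>w x\<close> were 0, then so would be \<open>a x\<close>, which equals
    \<nu> x \<bullet> w x.\<close>
  have w_nz: "w x \<noteq> 0" if "x \<in> topspace N" for x
    using \<nu>_w[OF that] a_nz[OF that] by auto
  have smooth_g: "smooth_map A g"
    using f \<nu> unfolding g_def pedal_def by simp
  then have smooth_w: "smooth_map A w"
    using f by (simp add: w_def)
  have orthogonal: "differential g v \<bullet> w x = 0"
    if x: "x \<in> topspace N" and v: "v \<in> tangent_space A x" for x v
  proof -
    have "differential \<nu> v \<bullet> w x = - ((f x - P) \<bullet> differential \<nu> v)"
      using differential_inner_unit_eq_0[OF v x \<nu> unit]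
      by (simp add: w inner_diff_right inner_commute)
    moreover have "differential g v =
        ((f x - P) \<bullet> differential \<nu> v) *\<^sub>R \<nu> x + a x *\<^sub>R differential \<nu> v"
      using differential_pedal[OF v f \<nu>] normal[OF x v] by (simp add: g_def a_def)
    ultimately show ?thesis
      using \<nu>_w[OF x] by (simp add: inner_add_left)
  qed
  \<comment> \<open>Dividing by the norm preserves orthogonality to dg, and it preserves smoothness
    because \<open>w\<close> has no zero on the manifold.\<close>
  have "frontal N A g (\<lambda>x. w x /\<^sub>R norm (w x))"
    using smooth_g smooth_w smooth_map_inverse_norm[OF smooth_w w_nz] w_nz orthogonal
    by (auto simp: frontal_def)
  \<comment> \<open>Since g - P = a \<nu>, the inner product with \<open>w\<close> is a (\<nu>
    \<bullet> w), that is, the square of \<open>a\<close>.\<close>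
  moreover have "(g x - P) \<bullet> (w x /\<^sub>R norm (w x)) \<noteq> 0" if "x \<in> topspace N" for x
    using \<nu>_w[OF that] a_nz[OF that] w_nz[OF that] by (simp add: g)
  ultimately show ?thesis
    by (simp add: Let_def g_def w_def)
qed

end
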